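(* Let $0<c<C$ and let $\lambda_0$ be a smooth function on $[c,C]$ with $\lambda_0>0$ and $\lambda_0'>0$. Let $\Omega_C=\{(s,t): s,t\ge0,\ c\le s+t\le C\}$. There is a constant $M$, depending on $\lambda_0$ and the interval $[c,C]$ but not on the perturbation $\delta\lambda$, such that the following holds. Let $x_0$ be a $C^2$ solution on $\Omega_C$ of $2\lambda_0(s+t)x_{st}+\lambda_0'(s+t)(x_s+x_t)=0$, with energy $E_0(u)$. For a perturbation $\delta\lambda$ of $\lambda_0$, the energy $E_1(u)$ of the corresponding first-order variation $x_1$ satisfies $$\sup_{u\in[c,C]}E_1(u)\le M\left(\sup_{u\in[c,C]}E_0(u)\right)\left\|\frac{d}{du}\left(\frac{\delta\lambda}{\lambda_0}\right)\right\|_{L^2(\lambda_0(u)\,du)}^2 .$$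
   Context: All coefficients are regarded as functions of $u=s+t$; primes denote $d/du$. The perturbation $\delta\lambda$ is a $C^1$ function on $[c,C]$. Energy: for $i=0,1$ and $u\in[c,C]$, $E_i(u)=\int_0^u\lambda_0(u)\Big(\big((x_i)_s(s,u-s)\big)^2+\big((x_i)_t(s,u-s)\big)^2\Big)\,ds$. First-order variation: $x_1$ is the $C^2$ solution on $\Omega_C$ of the linearized problem $2\lambda_0(s+t)(x_1)_{st}+\lambda_0'(s+t)\big((x_1)_s+(x_1)_t\big)=g(s,t)$, where $g(s,t)=-\lambda_0(u)\,\frac{d}{du}\!\left(\frac{\delta\lambda}{\lambda_0}\right)(u)\,\big((x_0)_s+(x_0)_t\big)(s,t)$ with $u=s+t$, with homogeneous boundary and initial conditions: $x_1(s,0)=0$ for $c\le s\le C$, $x_1(0,t)=0$ for $c\le t\le C$, and $x_1=0$, $(\partial_s+\partial_t)x_1=0$ on the segment $s+t=c$, $s,t\ge 0$. (This is the linearization of $2\lambda x_{st}+\lambda'(x_s+x_t)=0$ in the coefficient $\lambda$ at $\lambda_0$ in the direction $\delta\lambda$, with the boundary data of $x$ held fixed.) Weighted norm: $\|k\|_{L^2(\lambda_0(u)du)}^2=\int_c^C|k(u)|^2\lambda_0(u)\,du$. *)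

theory Defs
  imports "HOL-Analysis.Analysis"
begin

text \<open>Derivatives on the closed sets \<open>[c, C]\<close> and \<open>\<Omega>\<^sub>C\<close> are taken relative to the set,
  hence one-sided at boundary points. Both sets are convex with nonempty interior (for \<open>0 < c < C\<close>),
  so these derivatives are unique wherever they exist. For functions of two variables the
  total derivative within the set is used: at the corner \<open>(C, 0)\<close>, say, the set contains no
  segment in direction \<open>t\<close>, so that a one-dimensional difference quotient
  would not determine the \<open>t\<close>-derivative there.\<close>

definition deriv_on :: "real set \<Rightarrow> (real \<Rightarrow> real) \<Rightarrow> real \<Rightarrow> real" where
  "deriv_on I f u = vector_derivative f (at u within I)"

definition C1_on :: "real set \<Rightarrow> (real \<Rightarrow> real) \<Rightarrow> bool" where
  "C1_on I f \<longleftrightarrow> f differentiable_on I \<and> continuous_on I (deriv_on I f)"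

definition smooth_on :: "real set \<Rightarrow> (real \<Rightarrow> real) \<Rightarrow> bool" where
  "smooth_on I f \<longleftrightarrow> (\<forall>n. (deriv_on I ^^ n) f differentiable_on I)"

definition partial_s :: "(real \<times> real) set \<Rightarrow> (real \<times> real \<Rightarrow> real) \<Rightarrow> real \<times> real \<Rightarrow> real" where
  "partial_s S f p = frechet_derivative f (at p within S) (1, 0)"

definition partial_t :: "(real \<times> real) set \<Rightarrow> (real \<times> real \<Rightarrow> real) \<Rightarrow> real \<times> real \<Rightarrow> real" where
  "partial_t S f p = frechet_derivative f (at p within S) (0, 1)"

definition C1_on2 :: "(real \<times> real) set \<Rightarrow> (real \<times> real \<Rightarrow> real) \<Rightarrow> bool" where
  "C1_on2 S f \<longleftrightarrow> f differentiable_on S \<and>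
     continuous_on S (partial_s S f) \<and> continuous_on S (partial_t S f)"

definition C2_on2 :: "(real \<times> real) set \<Rightarrow> (real \<times> real \<Rightarrow> real) \<Rightarrow> bool" where
  "C2_on2 S f \<longleftrightarrow> C1_on2 S f \<and> C1_on2 S (partial_s S f) \<and> C1_on2 S (partial_t S f)"

definition Omega :: "real \<Rightarrow> real \<Rightarrow> (real \<times> real) set" where
  "Omega c C = {(s, t). 0 \<le> s \<and> 0 \<le> t \<and> c \<le> s + t \<and> s + t \<le> C}"

definition C2_solution ::
  "real \<Rightarrow> real \<Rightarrow> (real \<Rightarrow> real) \<Rightarrow> (real \<times> real \<Rightarrow> real) \<Rightarrow> (real \<times> real \<Rightarrow> real) \<Rightarrow> bool" where
  "C2_solution c C lam g x \<longleftrightarrow> C2_on2 (Omega c C) x \<and>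
     (\<forall>(s, t) \<in> Omega c C.
        2 * lam (s + t) * partial_t (Omega c C) (partial_s (Omega c C) x) (s, t)
        + deriv_on {c..C} lam (s + t)
          * (partial_s (Omega c C) x (s, t) + partial_t (Omega c C) x (s, t))
        = g (s, t))"

definition rel_perturbation_deriv ::
  "real \<Rightarrow> real \<Rightarrow> (real \<Rightarrow> real) \<Rightarrow> (real \<Rightarrow> real) \<Rightarrow> real \<Rightarrow> real" where
  "rel_perturbation_deriv c C lam0 dlam = deriv_on {c..C} (\<lambda>u. dlam u / lam0 u)"

text \<open>Linearizing \<open>2 \<lambda> x\<^sub>s\<^sub>t + \<lambda>' (x\<^sub>s + x\<^sub>t) = 0\<close> in \<open>\<lambda>\<close> at \<open>\<lambda>\<^sub>0\<close> leaves the source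
  \<open>- 2 \<delta>\<lambda> (x\<^sub>0)\<^sub>s\<^sub>t - \<delta>\<lambda>' ((x\<^sub>0)\<^sub>s + (x\<^sub>0)\<^sub>t)\<close>; eliminating \<open>(x\<^sub>0)\<^sub>s\<^sub>t\<close> by the equation for \<open>x\<^sub>0\<close>
  gives the form below.\<close>

definition variation_source ::
  "real \<Rightarrow> real \<Rightarrow> (real \<Rightarrow> real) \<Rightarrow> (real \<Rightarrow> real) \<Rightarrow> (real \<times> real \<Rightarrow> real) \<Rightarrow> real \<times> real \<Rightarrow> real" where
  "variation_source c C lam0 dlam x0 = (\<lambda>(s, t).
     - lam0 (s + t) * rel_perturbation_deriv c C lam0 dlam (s + t)
       * (partial_s (Omega c C) x0 (s, t) + partial_t (Omega c C) x0 (s, t)))"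

definition first_order_variation ::
  "real \<Rightarrow> real \<Rightarrow> (real \<Rightarrow> real) \<Rightarrow> (real \<Rightarrow> real) \<Rightarrow>
   (real \<times> real \<Rightarrow> real) \<Rightarrow> (real \<times> real \<Rightarrow> real) \<Rightarrow> bool" where
  "first_order_variation c C lam0 dlam x0 x1 \<longleftrightarrow>
     C2_solution c C lam0 (variation_source c C lam0 dlam x0) x1 \<and>
     (\<forall>s\<in>{c..C}. x1 (s, 0) = 0) \<and>
     (\<forall>t\<in>{c..C}. x1 (0, t) = 0) \<and>
     (\<forall>s t. 0 \<le> s \<longrightarrow> 0 \<le> t \<longrightarrow> s + t = c \<longrightarrow>
        x1 (s, t) = 0 \<and>
        partial_s (Omega c C) x1 (s, t) + partial_t (Omega c C) x1 (s, t) = 0)"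

definition energy ::
  "real \<Rightarrow> real \<Rightarrow> (real \<Rightarrow> real) \<Rightarrow> (real \<times> real \<Rightarrow> real) \<Rightarrow> real \<Rightarrow> real" where
  "energy c C lam0 x u = integral {0..u} (\<lambda>s. lam0 u *
     ((partial_s (Omega c C) x (s, u - s))\<^sup>2 + (partial_t (Omega c C) x (s, u - s))\<^sup>2))"

definition weighted_L2_norm :: "real \<Rightarrow> real \<Rightarrow> (real \<Rightarrow> real) \<Rightarrow> (real \<Rightarrow> real) \<Rightarrow> real" where
  "weighted_L2_norm c C w k = sqrt (integral {c..C} (\<lambda>u. \<bar>k u\<bar>\<^sup>2 * w u))"

end

theory Submission
  imports Defs
begin

text \<open>Write \<open>p = (x\<^sub>1)\<^sub>s\<close>, \<open>q = (x\<^sub>1)\<^sub>t\<close>, \<open>p\<^sub>0 = (x\<^sub>0)\<^sub>s\<close>, \<open>q\<^sub>0 = (x\<^sub>0)\<^sub>t\<close>, \<open>k = (\<delta>\<lambda> / \<lambda>\<^sub>0)'\<close>, and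
  let \<open>G\<^sub>i = E\<^sub>i / \<lambda>\<^sub>0\<close> be the energy without its weight. The proof is an energy estimate followed by
  a Gronwall argument.

  Differentiating \<open>\<integral> p\<^sup>2\<close> over the slice \<open>s + t = u\<close> in the \<open>t\<close>-direction and \<open>\<integral> q\<^sup>2\<close> in the
  \<open>s\<close>-direction produces the boundary terms \<open>p\<^sup>2(u, 0)\<close> and \<open>q\<^sup>2(0, u)\<close>, which vanish because \<open>x\<^sub>1\<close> is
  zero on both axes. What remains is \<open>G\<^sub>1' = \<integral> 2 p p\<^sub>t + 2 q q\<^sub>s\<close>. Since mixed partials commute, the
  differential equation gives both \<open>2 \<lambda>\<^sub>0 p\<^sub>t\<close> and \<open>2 \<lambda>\<^sub>0 q\<^sub>s\<close> as \<open>g - \<lambda>\<^sub>0' (p + q)\<close>, so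
  \<open>\<lambda>\<^sub>0 (2 p p\<^sub>t + 2 q q\<^sub>s) = (p + q) g - \<lambda>\<^sub>0' (p + q)\<^sup>2 \<le> (p + q) g = - \<lambda>\<^sub>0 k (p\<^sub>0 + q\<^sub>0) (p + q)\<close>.
  This is where \<open>\<lambda>\<^sub>0' > 0\<close> enters. Young's inequality then yields \<open>G\<^sub>1' \<le> k\<^sup>2 G\<^sub>0 + G\<^sub>1\<close>
  (lemma \<open>slice_energy_growth\<close>).

  The initial conditions force \<open>G\<^sub>1(c) = 0\<close>, whence \<open>G\<^sub>1(u) \<le> e\<^bsup>C-c\<^esup> \<integral> k\<^sup>2 G\<^sub>0\<close>. With
  \<open>m \<le> \<lambda>\<^sub>0 \<le> B\<close> on \<open>[c, C]\<close> one has \<open>G\<^sub>0 \<le> sup E\<^sub>0 / \<lambda>\<^sub>0 \<le> sup E\<^sub>0 \<lambda>\<^sub>0 / m\<^sup>2\<close>, which turns \<open>\<integral> k\<^sup>2 G\<^sub>0\<close> into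
  the weighted norm and shows that \<open>M = B e\<^bsup>C-c\<^esup> / m\<^sup>2\<close> works.\<close>

section \<open>Continuously differentiable functions on planar sets\<close>

lemma has_real_derivative_unique_Icc:
  fixes f :: "real \<Rightarrow> real"
  assumes "(f has_real_derivative d) (at x within {a..b})"
    and "(f has_real_derivative e) (at x within {a..b})" and "a < b" "x \<in> {a..b}"
  shows "d = e"
proof -
  have "at x within {a..b} \<noteq> bot"
    using assms by (simp add: trivial_limit_within islimpt_Icc)
  with assms show ?thesis by (metis has_field_derivative_unique)
qed

text \<open>The partial derivatives are explicit arguments because those of a product or a square can then
  be written down by the usual rules, whereas \<^const>\<open>partial_s\<close> and \<^const>\<open>partial_t\<close> choose some
  derivative, which would first have to be identified by a uniqueness argument.\<close>

definition C1_with_partials ::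
  "(real \<times> real) set \<Rightarrow> (real \<times> real \<Rightarrow> real) \<Rightarrow> (real \<times> real \<Rightarrow> real) \<Rightarrow> (real \<times> real \<Rightarrow> real) \<Rightarrow> bool"
where
  "C1_with_partials S f fs ft \<longleftrightarrow>
     (\<forall>z\<in>S. (f has_derivative (\<lambda>h. fs z * fst h + ft z * snd h)) (at z within S)) \<and>
     continuous_on S fs \<and> continuous_on S ft"

text \<open>The total derivative is linear, hence determined by its values on the two unit vectors.\<close>

lemma C1_on2_imp_C1_with_partials:
  assumes "C1_on2 S f"
  shows "C1_with_partials S f (partial_s S f) (partial_t S f)"
proof -
  have "(f has_derivative (\<lambda>h. partial_s S f z * fst h + partial_t S f z * snd h)) (at z within S)"
    if "z \<in> S" for z
  proof -
    define D where "D = frechet_derivative f (at z within S)"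
    have D: "(f has_derivative D) (at z within S)"
      using assms that by (auto simp: C1_on2_def differentiable_on_def D_def frechet_derivative_works)
    then interpret D: linear D by (rule has_derivative_linear)
    have "D h = partial_s S f z * fst h + partial_t S f z * snd h" for h
    proof -
      have "h = fst h *\<^sub>R (1, 0) + snd h *\<^sub>R (0, 1)" by (simp add: prod_eq_iff)
      then have "D h = fst h *\<^sub>R D (1, 0) + snd h *\<^sub>R D (0, 1)"
        by (metis D.add D.scale)
      then show ?thesis by (simp add: partial_s_def partial_t_def D_def)
    qed
    then have "D = (\<lambda>h. partial_s S f z * fst h + partial_t S f z * snd h)" by blast
    with D show ?thesis by simp
  qed
  then show ?thesis using assms by (simp add: C1_with_partials_def C1_on2_def)
qed

lemma C1_with_partials_continuous:
  "C1_with_partials S f fs ft \<Longrightarrow> continuous_on S f"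
  unfolding C1_with_partials_def
  by (intro has_derivative_continuous_on[where f' = "\<lambda>z h. fs z * fst h + ft z * snd h"]) auto

lemma C1_with_partials_power2:
  assumes "C1_with_partials S f fs ft"
  shows "C1_with_partials S (\<lambda>z. (f z)\<^sup>2) (\<lambda>z. 2 * f z * fs z) (\<lambda>z. 2 * f z * ft z)"
proof -
  have "((\<lambda>z. (f z)\<^sup>2) has_derivative (\<lambda>h. 2 * f z * fs z * fst h + 2 * f z * ft z * snd h))
      (at z within S)" if "z \<in> S" for z
  proof -
    have "(f has_derivative (\<lambda>h. fs z * fst h + ft z * snd h)) (at z within S)"
      using assms that by (simp add: C1_with_partials_def)
    from has_derivative_power[OF this, of 2] show ?thesis by (simp add: algebra_simps)
  qed
  moreover have "continuous_on S fs" "continuous_on S ft"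
    using assms by (auto simp: C1_with_partials_def)
  ultimately show ?thesis
    using C1_with_partials_continuous[OF assms]
    by (auto simp: C1_with_partials_def intro!: continuous_intros)
qed

text \<open>The chain rule relative to the set: a path that stays in \<open>S\<close> may run along the boundary of
  \<open>S\<close>, which is how boundary data are differentiated and how slices are followed up to their ends.\<close>

lemma C1_with_partials_chain:
  assumes f: "C1_with_partials S f fs ft"
    and a: "(a has_real_derivative a') (at r within A)"
    and b: "(b has_real_derivative b') (at r within A)"
    and S: "\<And>r. r \<in> A \<Longrightarrow> (a r, b r) \<in> S" and "r \<in> A"
  shows "((\<lambda>r. f (a r, b r)) has_real_derivative fs (a r, b r) * a' + ft (a r, b r) * b')
    (at r within A)"
proof -
  have ab: "((\<lambda>r. (a r, b r)) has_derivative (\<lambda>h. (a' * h, b' * h))) (at r within A)"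
    using a b by (auto simp: has_field_derivative_def intro!: has_derivative_Pair)
  have "(f has_derivative (\<lambda>h. fs (a r, b r) * fst h + ft (a r, b r) * snd h))
      (at (a r, b r) within (\<lambda>r. (a r, b r)) ` A)"
    using f S \<open>r \<in> A\<close> by (auto simp: C1_with_partials_def intro: has_derivative_subset)
  from has_derivative_in_compose[OF ab this]
  show ?thesis
    unfolding has_field_derivative_def
    by (rule has_derivative_eq_rhs) (simp add: fun_eq_iff algebra_simps)
qed

text \<open>Writing \<open>f\<close> as its value on the left edge of the rectangle plus the integral of \<open>f\<^sub>s\<close> and
  differentiating in \<open>t\<close> under the integral expresses \<open>f\<^sub>t\<close> as an integral of \<open>f\<^sub>s\<^sub>t\<close>, which the
  fundamental theorem then differentiates in \<open>s\<close>.\<close>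

lemma mixed_partials_commute_rectangle:
  assumes f: "C1_with_partials S f fs ft"
    and fs: "C1_with_partials S fs fss fst'" and ft: "C1_with_partials S ft fts ftt"
    and S: "{a..b} \<times> {d..e} \<subseteq> S" and "a < b" "d < e"
    and s: "s \<in> {a..b}" and t: "t \<in> {d..e}"
  shows "fst' (s, t) = fts (s, t)"
proof -
  have in_S: "(s, t) \<in> S" if "s \<in> {a..b}" "t \<in> {d..e}" for s t using S that by auto
  have cont: "continuous_on S fs" "continuous_on S fst'"
    using f fs by (auto simp: C1_with_partials_def)
  have f_eq: "f (s, t) = f (a, t) + integral {a..s} (\<lambda>r. fs (r, t))"
    if s: "s \<in> {a..b}" and t: "t \<in> {d..e}" for s t
  proof -
    have "((\<lambda>r. fs (r, t)) has_integral f (s, t) - f (a, t)) {a..s}"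
    proof (rule fundamental_theorem_of_calculus)
      fix r assume r: "r \<in> {a..s}"
      have "((\<lambda>r. f (r, t)) has_real_derivative fs (r, t) * 1 + ft (r, t) * 0) (at r within {a..s})"
        by (rule C1_with_partials_chain[OF f]) (use s t r in_S in \<open>auto intro!: derivative_eq_intros\<close>)
      then show "((\<lambda>r. f (r, t)) has_vector_derivative fs (r, t)) (at r within {a..s})"
        by (simp add: has_real_derivative_iff_has_vector_derivative)
    qed (use s in auto)
    then show ?thesis by (simp add: integral_unique)
  qed
  have ft_eq: "ft (s, t) = ft (a, t) + integral {a..s} (\<lambda>r. fst' (r, t))" if s: "s \<in> {a..b}" for s
  proof -
    have "((\<lambda>t. integral (cbox a s) (\<lambda>r. fs (r, t))) has_field_derivative
        integral (cbox a s) (\<lambda>r. fst' (r, t))) (at t within {d..e})"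
    proof (rule leibniz_rule_field_derivative)
      fix t r assume t: "t \<in> {d..e}" and r: "r \<in> cbox a s"
      have "((\<lambda>t. fs (r, t)) has_real_derivative fss (r, t) * 0 + fst' (r, t) * 1) (at t within {d..e})"
        by (rule C1_with_partials_chain[OF fs]) (use s t r in_S in \<open>auto intro!: derivative_eq_intros\<close>)
      then show "((\<lambda>t. fs (r, t)) has_real_derivative fst' (r, t)) (at t within {d..e})" by simp
    next
      fix t assume t: "t \<in> {d..e}"
      show "(\<lambda>r. fs (r, t)) integrable_on cbox a s"
        by (intro integrable_continuous continuous_on_compose2[OF cont(1)] continuous_intros)
          (use s t in_S in auto)
    next
      show "continuous_on ({d..e} \<times> cbox a s) (\<lambda>(t, r). fst' (r, t))"
        unfolding split_beta
        by (intro continuous_on_compose2[OF cont(2)] continuous_intros) (use s in_S in auto)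
    qed (use t in auto)
    moreover have "((\<lambda>t. f (a, t)) has_real_derivative fs (a, t) * 0 + ft (a, t) * 1) (at t within {d..e})"
      by (rule C1_with_partials_chain[OF f]) (use s t in_S in \<open>auto intro!: derivative_eq_intros\<close>)
    ultimately have "((\<lambda>t. f (a, t) + integral {a..s} (\<lambda>r. fs (r, t))) has_real_derivative
        ft (a, t) + integral {a..s} (\<lambda>r. fst' (r, t))) (at t within {d..e})"
      by (auto intro!: derivative_eq_intros)
    then have "((\<lambda>t. f (s, t)) has_real_derivative
        ft (a, t) + integral {a..s} (\<lambda>r. fst' (r, t))) (at t within {d..e})"
      unfolding has_field_derivative_def by (rule has_derivative_transform[OF t, rotated]) (rule f_eq[OF s])
    moreover have "((\<lambda>t. f (s, t)) has_real_derivative fs (s, t) * 0 + ft (s, t) * 1) (at t within {d..e})"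
      by (rule C1_with_partials_chain[OF f]) (use s t in_S in \<open>auto intro!: derivative_eq_intros\<close>)
    ultimately show ?thesis
      using has_real_derivative_unique_Icc[OF _ _ \<open>d < e\<close> t] by force
  qed
  have "((\<lambda>s. ft (s, t)) has_real_derivative fts (s, t) * 1 + ftt (s, t) * 0) (at s within {a..b})"
    by (rule C1_with_partials_chain[OF ft]) (use s t in_S in \<open>auto intro!: derivative_eq_intros\<close>)
  moreover have "continuous_on {a..b} (\<lambda>r. fst' (r, t))"
    by (intro continuous_on_compose2[OF cont(2)] continuous_intros) (use t in_S in auto)
  then have "((\<lambda>s. integral {a..s} (\<lambda>r. fst' (r, t))) has_real_derivative fst' (s, t)) (at s within {a..b})"
    by (rule integral_has_real_derivative) (use s in auto)
  then have "((\<lambda>s. ft (a, t) + integral {a..s} (\<lambda>r. fst' (r, t))) has_real_derivative fst' (s, t))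
      (at s within {a..b})"
    by (auto intro!: derivative_eq_intros)
  then have "((\<lambda>s. ft (s, t)) has_real_derivative fst' (s, t)) (at s within {a..b})"
    unfolding has_field_derivative_def by (rule has_derivative_transform[OF s, rotated]) (rule ft_eq)
  ultimately show ?thesis
    using has_real_derivative_unique_Icc[OF _ _ \<open>a < b\<close> s] by force
qed

text \<open>An interior point has a rectangle around it inside \<open>S\<close>; continuity of both second
  derivatives carries the equality to the boundary.\<close>

lemma C2_on2_mixed_partials_commute:
  assumes "C2_on2 S f" and "convex S" and "interior S \<noteq> {}" and "z \<in> S"
  shows "partial_t S (partial_s S f) z = partial_s S (partial_t S f) z"
proof -
  define D where "D z = partial_t S (partial_s S f) z - partial_s S (partial_t S f) z" for z
  note C1 = assms(1)[unfolded C2_on2_def]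
  have P: "C1_with_partials S f (partial_s S f) (partial_t S f)"
    "C1_with_partials S (partial_s S f) (partial_s S (partial_s S f)) (partial_t S (partial_s S f))"
    "C1_with_partials S (partial_t S f) (partial_s S (partial_t S f)) (partial_t S (partial_t S f))"
    using C1 by (simp_all add: C1_on2_imp_C1_with_partials)
  have int: "D z = 0" if "z \<in> interior S" for z
  proof -
    obtain s t where z: "z = (s, t)" by (cases z)
    from that obtain U V where UV: "open U" "open V" "z \<in> U \<times> V" "U \<times> V \<subseteq> interior S"
      using open_prod_elim[OF open_interior] by metis
    obtain d where d: "d > 0" "cball s d \<subseteq> U"
      using UV z open_contains_cball by blast
    obtain e where e: "e > 0" "cball t e \<subseteq> V"
      using UV z open_contains_cball by blast
    have "{s - d..s + d} \<times> {t - e..t + e} \<subseteq> S"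
      using d e UV interior_subset[of S] unfolding cball_eq_atLeastAtMost by blast
    from mixed_partials_commute_rectangle[OF P this]
    show ?thesis using d e z by (auto simp: D_def)
  qed
  have "continuous_on S D"
    using P unfolding D_def C1_with_partials_def by (auto intro!: continuous_intros)
  \<comment> \<open>The interior is dense in a convex set with nonempty interior.\<close>
  have sub: "S \<subseteq> closure (interior S)"
    using convex_closure_interior[OF assms(2,3)] closure_subset by auto
  show ?thesis
  proof -
    obtain w where w: "\<And>n. w n \<in> interior S" "w \<longlonglongrightarrow> z"
      using sub \<open>z \<in> S\<close> closure_sequential by blast
    have "(\<lambda>n. D (w n)) \<longlonglongrightarrow> D z"
      using \<open>continuous_on S D\<close> w \<open>z \<in> S\<close> interior_subset[of S]
      by (auto simp: continuous_on_sequentially o_def)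
    then have "D z = 0" using int w(1) by (simp add: LIMSEQ_const_iff)
    then show ?thesis by (simp add: D_def)
  qed
qed

section \<open>Integrals over the slices \<open>s + t = u\<close>\<close>

text \<open>The integral of \<open>f\<close> over the slice \<open>s + t = u\<close>, parametrized over the fixed interval \<open>[0, 1]\<close>
  so that one can differentiate in \<open>u\<close> under the integral.\<close>

definition slice_integral :: "(real \<times> real \<Rightarrow> real) \<Rightarrow> real \<Rightarrow> real" where
  "slice_integral f u = u * integral {0..1} (\<lambda>r. f (u * r, u * (1 - r)))"

lemma slice_in_Omega:
  assumes "0 < c" "u \<in> {c..C}" "r \<in> {0..1}"
  shows "(u * r, u * (1 - r)) \<in> Omega c C"
  using assms by (auto simp: Omega_def algebra_simps mult_left_le)

lemma slice_continuous_on: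
  assumes "0 < c" "u \<in> {c..C}" "continuous_on (Omega c C) f"
  shows "continuous_on {0..1} (\<lambda>r. f (u * r, u * (1 - r)))"
  by (intro continuous_on_compose2[OF assms(3)] continuous_intros)
    (use slice_in_Omega[OF assms(1,2)] in auto)

lemma slice_integral_eq:
  assumes "0 < c" "u \<in> {c..C}" "continuous_on (Omega c C) f"
  shows "slice_integral f u = integral {0..u} (\<lambda>s. f (s, u - s))"
proof -
  have u: "u > 0" using assms by auto
  have "continuous_on {0..u} (\<lambda>s. f (s, u - s))"
    by (intro continuous_on_compose2[OF assms(3)] continuous_intros)
      (use assms in \<open>auto simp: Omega_def\<close>)
  then have "((\<lambda>s. f (s, u - s)) has_integral integral {0..u} (\<lambda>s. f (s, u - s))) {0..u}"
    by (simp add: integrable_continuous_real integrable_integral)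
  \<comment> \<open>Substitute \<open>s = u r\<close>.\<close>
  from has_integral_stretch_real[OF this, of u] u
  have "((\<lambda>r. f (u * r, u - u * r)) has_integral (1 / u) * integral {0..u} (\<lambda>s. f (s, u - s)))
      ((\<lambda>x. x / u) ` {0..u})" by simp
  moreover have "(\<lambda>x. x / u) ` {0..u} = {0..1}" using u by simp
  ultimately show ?thesis using u
    by (simp add: slice_integral_def integral_unique right_diff_distrib)
qed

lemma slice_integral_mono:
  assumes "0 < c" "u \<in> {c..C}" "continuous_on (Omega c C) f" "continuous_on (Omega c C) g"
    and "\<And>s t. (s, t) \<in> Omega c C \<Longrightarrow> s + t = u \<Longrightarrow> f (s, t) \<le> g (s, t)"
  shows "slice_integral f u \<le> slice_integral g u"
  unfolding slice_integral_def
proof (intro mult_left_mono integral_le)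
  fix r :: real assume "r \<in> {0..1}"
  then show "f (u * r, u * (1 - r)) \<le> g (u * r, u * (1 - r))"
    using slice_in_Omega[OF assms(1,2)] by (intro assms(5)) (auto simp: algebra_simps)
qed (use assms in \<open>auto intro!: integrable_continuous_real slice_continuous_on\<close>)

lemma slice_integral_add:
  assumes "0 < c" "u \<in> {c..C}" "continuous_on (Omega c C) f" "continuous_on (Omega c C) g"
  shows "slice_integral (\<lambda>z. f z + g z) u = slice_integral f u + slice_integral g u"
  unfolding slice_integral_def distrib_left[symmetric]
  by (subst integral_add)
    (use assms in \<open>auto intro!: integrable_continuous_real slice_continuous_on\<close>)

lemma slice_integral_mult: "slice_integral (\<lambda>z. a * f z) u = a * slice_integral f u"
  by (simp add: slice_integral_def)

lemma slice_integral_nonneg: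
  assumes "0 < c" "u \<in> {c..C}" "continuous_on (Omega c C) f" and "\<And>z. 0 \<le> f z"
  shows "0 \<le> slice_integral f u"
  unfolding slice_integral_def
  by (intro mult_nonneg_nonneg integral_nonneg integrable_continuous_real slice_continuous_on[OF assms(1-3)])
    (use assms in auto)

lemma slice_integral_eq_0:
  assumes "0 < c" "u \<in> {c..C}"
    and "\<And>s t. (s, t) \<in> Omega c C \<Longrightarrow> s + t = u \<Longrightarrow> f (s, t) = 0"
  shows "slice_integral f u = 0"
proof -
  have "f (u * r, u * (1 - r)) = 0" if "r \<in> {0..1}" for r
    using slice_in_Omega[OF assms(1,2) that] by (intro assms(3)) (auto simp: algebra_simps)
  then have "integral {0..1} (\<lambda>r. f (u * r, u * (1 - r))) = integral {0..1::real} (\<lambda>r. 0)"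
    by (rule Henstock_Kurzweil_Integration.integral_cong)
  then show ?thesis by (simp add: slice_integral_def)
qed

text \<open>Moving a slice outwards in the pure \<open>t\<close>-direction uncovers the endpoint \<open>(u, 0)\<close>, moving it
  in the pure \<open>s\<close>-direction the endpoint \<open>(0, u)\<close>. The radial derivative obtained from the
  parametrization differs from either one by the total derivative of \<open>r f\<close>, respectively of
  \<open>(r - 1) f\<close>, along the slice.\<close>

lemma slice_integral_has_derivative:
  assumes f: "C1_with_partials (Omega c C) f fs ft" and c: "0 < c" and u: "u \<in> {c..C}"
  shows "(slice_integral f has_real_derivative f (u, 0) + slice_integral ft u) (at u within {c..C})"
    and "(slice_integral f has_real_derivative f (0, u) + slice_integral fs u) (at u within {c..C})"
proof -
  let ?p = "\<lambda>r. (u * r, u * (1 - r))"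
  have cf: "continuous_on (Omega c C) f" "continuous_on (Omega c C) fs" "continuous_on (Omega c C) ft"
    using f C1_with_partials_continuous[OF f] by (auto simp: C1_with_partials_def)
  note cs = cf[THEN slice_continuous_on[OF c u]]
  let ?R = "\<lambda>u r. r * fs (u * r, u * (1 - r)) + (1 - r) * ft (u * r, u * (1 - r))"
  have "((\<lambda>u. integral (cbox 0 1) (\<lambda>r. f (u * r, u * (1 - r)))) has_real_derivative
      integral (cbox 0 1) (?R u)) (at u within {c..C})"
  proof (rule leibniz_rule_field_derivative)
    fix u r :: real assume u: "u \<in> {c..C}" and r: "r \<in> cbox 0 1"
    have "((\<lambda>u. f (u * r, u * (1 - r))) has_real_derivative
       fs (u * r, u * (1 - r)) * r + ft (u * r, u * (1 - r)) * (1 - r)) (at u within {c..C})"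
      by (rule C1_with_partials_chain[OF f])
        (use slice_in_Omega[OF c] r u in \<open>auto intro!: derivative_eq_intros\<close>)
    then show "((\<lambda>u. f (u * r, u * (1 - r))) has_real_derivative ?R u r) (at u within {c..C})"
      by (simp add: mult.commute)
  next
    fix u :: real assume "u \<in> {c..C}"
    then show "(\<lambda>r. f (u * r, u * (1 - r))) integrable_on cbox 0 1"
      using slice_continuous_on[OF c _ cf(1)] by (simp add: integrable_continuous_real)
  next
    show "continuous_on ({c..C} \<times> cbox 0 1) (\<lambda>(u, r). ?R u r)"
      unfolding split_beta
      by (intro continuous_intros continuous_on_compose2[OF cf(2)] continuous_on_compose2[OF cf(3)])
        (use slice_in_Omega[OF c] in auto)
  qed (use u in auto)
  then have D: "(slice_integral f has_real_derivative
      integral {0..1} (\<lambda>r. f (?p r)) + u * integral {0..1} (?R u)) (at u within {c..C})"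
    unfolding slice_integral_def by (auto intro!: derivative_eq_intros)
  have eq: "integral {0..1} (\<lambda>r. f (?p r)) + u * integral {0..1} (?R u)
      = integral {0..1} (\<lambda>r. f (?p r) + u * ?R u r)"
    by (subst integral_add) (auto intro!: integrable_continuous_real continuous_intros cs)
  have along: "((\<lambda>r. f (?p r)) has_real_derivative u * (fs (?p r) - ft (?p r))) (at r within {0..1})"
    if r: "r \<in> {0..1}" for r
  proof -
    have "((\<lambda>r. f (?p r)) has_real_derivative fs (?p r) * u + ft (?p r) * (- u)) (at r within {0..1})"
      by (rule C1_with_partials_chain[OF f])
        (use slice_in_Omega[OF c u] r in \<open>auto intro!: derivative_eq_intros\<close>)
    then show ?thesis by (simp add: algebra_simps)
  qed
  \<comment> \<open>First form: \<open>f + u (r f\<^sub>s + (1 - r) f\<^sub>t) = (r f)' + u f\<^sub>t\<close>.\<close>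
  have I1: "((\<lambda>r. f (?p r) + r * (u * (fs (?p r) - ft (?p r)))) has_integral
      (1 * f (?p 1) - 0 * f (?p 0))) {0..1}"
    by (rule fundamental_theorem_of_calculus[where f = "\<lambda>r. r * f (?p r)"])
      (auto simp flip: has_real_derivative_iff_has_vector_derivative
        intro!: derivative_eq_intros along)
  have I2: "((\<lambda>r. u * ft (?p r)) has_integral slice_integral ft u) {0..1}"
    unfolding slice_integral_def
    by (intro has_integral_mult_right integrable_integral integrable_continuous_real cs)
  from has_integral_add[OF I1 I2] have "((\<lambda>r. f (?p r) + r * (u * (fs (?p r) - ft (?p r))) + u * ft (?p r)) has_integral
      f (u, 0) + slice_integral ft u) {0..1}"
    by simp
  then have "integral {0..1} (\<lambda>r. f (?p r) + u * ?R u r) = f (u, 0) + slice_integral ft u"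
    by (intro integral_unique) (simp add: algebra_simps)
  with D eq show "(slice_integral f has_real_derivative f (u, 0) + slice_integral ft u) (at u within {c..C})"
    by simp
  \<comment> \<open>Second form: \<open>f + u (r f\<^sub>s + (1 - r) f\<^sub>t) = ((r - 1) f)' + u f\<^sub>s\<close>.\<close>
  have J1: "((\<lambda>r. f (?p r) + (r - 1) * (u * (fs (?p r) - ft (?p r)))) has_integral
      ((1 - 1) * f (?p 1) - (0 - 1) * f (?p 0))) {0..1}"
    by (rule fundamental_theorem_of_calculus[where f = "\<lambda>r. (r - 1) * f (?p r)"])
      (auto simp flip: has_real_derivative_iff_has_vector_derivative
        intro!: derivative_eq_intros along)
  have J2: "((\<lambda>r. u * fs (?p r)) has_integral slice_integral fs u) {0..1}"
    unfolding slice_integral_def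
    by (intro has_integral_mult_right integrable_integral integrable_continuous_real cs)
  from has_integral_add[OF J1 J2] have "((\<lambda>r. f (?p r) + (r - 1) * (u * (fs (?p r) - ft (?p r))) + u * fs (?p r)) has_integral
      f (0, u) + slice_integral fs u) {0..1}"
    by simp
  then have "integral {0..1} (\<lambda>r. f (?p r) + u * ?R u r) = f (0, u) + slice_integral fs u"
    by (intro integral_unique) (simp add: algebra_simps)
  with D eq show "(slice_integral f has_real_derivative f (0, u) + slice_integral fs u) (at u within {c..C})"
    by simp
qed

lemma convex_Omega: "convex (Omega c C)"
proof -
  have "Omega c C = {z. inner (1, 0) z \<ge> 0} \<inter> {z. inner (0, 1) z \<ge> 0} \<inter>
      {z. inner (1, 1) z \<ge> c} \<inter> {z. inner (1, 1) z \<le> C}"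
    by (auto simp: Omega_def inner_prod_def)
  then show ?thesis
    by (auto intro!: convex_Int convex_halfspace_le convex_halfspace_ge)
qed

lemma interior_Omega_nonempty:
  assumes "0 < c" "c < C"
  shows "interior (Omega c C) \<noteq> {}"
proof -
  have "open {z :: real \<times> real. 0 < fst z \<and> 0 < snd z \<and> c < fst z + snd z \<and> fst z + snd z < C}"
    by (intro open_Collect_conj open_Collect_less continuous_intros)
  moreover have "{z. 0 < fst z \<and> 0 < snd z \<and> c < fst z + snd z \<and> fst z + snd z < C} \<subseteq> Omega c C"
    by (auto simp: Omega_def)
  moreover have "((c + C) / 4, (c + C) / 4) \<in>
      {z :: real \<times> real. 0 < fst z \<and> 0 < snd z \<and> c < fst z + snd z \<and> fst z + snd z < C}"
    using assms by (auto simp: field_simps)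
  ultimately show ?thesis using interior_maximal by blast
qed

section \<open>The energy of the first-order variation\<close>

lemma energy_eq_slice_integral:
  assumes "0 < c" "u \<in> {c..C}" "C2_on2 (Omega c C) x"
  shows "energy c C lam x u = lam u *
    slice_integral (\<lambda>z. (partial_s (Omega c C) x z)\<^sup>2 + (partial_t (Omega c C) x z)\<^sup>2) u"
proof -
  have "continuous_on (Omega c C) (\<lambda>z. (partial_s (Omega c C) x z)\<^sup>2 + (partial_t (Omega c C) x z)\<^sup>2)"
    using assms(3) by (auto simp: C2_on2_def C1_on2_def intro!: continuous_intros)
  from slice_integral_eq[OF assms(1,2) this] show ?thesis by (simp add: energy_def)
qed

text \<open>Zero data on a segment annihilate the derivative along it. On \<open>s + t = c\<close> this is
  \<open>x\<^sub>s - x\<^sub>t\<close>, and the remaining combination \<open>x\<^sub>s + x\<^sub>t\<close> is prescribed to vanish there.\<close>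

lemma vanishing_boundary_partials:
  assumes C1: "C1_with_partials (Omega c C) x xs xt" and cC: "0 < c" "c < C"
    and s0: "\<forall>s\<in>{c..C}. x (s, 0) = 0" and t0: "\<forall>t\<in>{c..C}. x (0, t) = 0"
    and init: "\<And>s t. 0 \<le> s \<Longrightarrow> 0 \<le> t \<Longrightarrow> s + t = c \<Longrightarrow> x (s, t) = 0 \<and> xs (s, t) + xt (s, t) = 0"
  shows "u \<in> {c..C} \<Longrightarrow> xs (u, 0) = 0"
    and "u \<in> {c..C} \<Longrightarrow> xt (0, u) = 0"
    and "0 \<le> s \<Longrightarrow> 0 \<le> t \<Longrightarrow> s + t = c \<Longrightarrow> xs (s, t) = 0 \<and> xt (s, t) = 0"
proof -
  have zero: "d = 0" if f: "(f has_real_derivative d) (at r within {a..b})"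
    and "a < b" "r \<in> {a..b}" and 0: "\<And>r. r \<in> {a..b} \<Longrightarrow> f r = 0" for f and d r a b :: real
  proof -
    have "(f has_real_derivative 0) (at r within {a..b})"
      using 0 by (intro has_field_derivative_transform_within[OF DERIV_const, of 1 r])
        (use \<open>r \<in> {a..b}\<close> in auto)
    with f show ?thesis using \<open>a < b\<close> \<open>r \<in> {a..b}\<close> by (rule has_real_derivative_unique_Icc)
  qed
  show "xs (u, 0) = 0" if u: "u \<in> {c..C}"
  proof -
    have "((\<lambda>r. x (r, 0)) has_real_derivative xs (u, 0) * 1 + xt (u, 0) * 0) (at u within {c..C})"
      by (rule C1_with_partials_chain[OF C1])
        (use u cC in \<open>auto simp: Omega_def intro!: derivative_eq_intros\<close>)
    then have "xs (u, 0) * 1 + xt (u, 0) * 0 = 0" by (rule zero) (use s0 u cC in auto)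
    then show ?thesis by simp
  qed
  show "xt (0, u) = 0" if u: "u \<in> {c..C}"
  proof -
    have "((\<lambda>r. x (0, r)) has_real_derivative xs (0, u) * 0 + xt (0, u) * 1) (at u within {c..C})"
      by (rule C1_with_partials_chain[OF C1])
        (use u cC in \<open>auto simp: Omega_def intro!: derivative_eq_intros\<close>)
    then have "xs (0, u) * 0 + xt (0, u) * 1 = 0" by (rule zero) (use t0 u cC in auto)
    then show ?thesis by simp
  qed
  show "xs (s, t) = 0 \<and> xt (s, t) = 0" if st: "0 \<le> s" "0 \<le> t" "s + t = c"
  proof -
    have t: "t = c - s" using st by simp
    have "((\<lambda>r. x (r, c - r)) has_real_derivative xs (s, c - s) * 1 + xt (s, c - s) * (- 1))
        (at s within {0..c})"
      by (rule C1_with_partials_chain[OF C1])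
        (use st cC in \<open>auto simp: Omega_def intro!: derivative_eq_intros\<close>)
    then have "xs (s, c - s) * 1 + xt (s, c - s) * (- 1) = 0"
      by (rule zero) (use init st cC in auto)
    then show ?thesis using init[OF st] t by simp
  qed
qed

text \<open>The pointwise heart of the energy estimate. Adding \<open>p\<close> times the first equation and \<open>q\<close> times
  the second makes the lower-order terms the square \<open>- L' (p + q)\<^sup>2\<close>, which is discarded; the rest
  is bounded with \<open>- X Y \<le> (X\<^sup>2 + Y\<^sup>2) / 2\<close> and \<open>(a + b)\<^sup>2 \<le> 2 (a\<^sup>2 + b\<^sup>2)\<close>.\<close>

lemma energy_density_growth_bound:
  fixes L L' k p q p0 q0 pt qs :: real
  assumes "L > 0" "L' > 0"
    and "2 * L * pt + L' * (p + q) = - L * k * (p0 + q0)"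
    and "2 * L * qs + L' * (p + q) = - L * k * (p0 + q0)"
  shows "2 * p * pt + 2 * q * qs \<le> k\<^sup>2 * (p0\<^sup>2 + q0\<^sup>2) + (p\<^sup>2 + q\<^sup>2)"
proof -
  have "L * (2 * p * pt + 2 * q * qs) = p * (2 * L * pt) + q * (2 * L * qs)" by algebra
  also have "\<dots> = p * (- L * k * (p0 + q0) - L' * (p + q)) + q * (- L * k * (p0 + q0) - L' * (p + q))"
  proof -
    have "2 * L * pt = - L * k * (p0 + q0) - L' * (p + q)"
      "2 * L * qs = - L * k * (p0 + q0) - L' * (p + q)"
      using assms(3,4) by linarith+
    then show ?thesis by (simp only:)
  qed
  also have "\<dots> = L * (- k * (p0 + q0) * (p + q)) - L' * (p + q)\<^sup>2"
    by (simp add: algebra_simps power2_eq_square)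
  also have "\<dots> \<le> L * (- k * (p0 + q0) * (p + q))" using \<open>L' > 0\<close> by simp
  finally have "2 * p * pt + 2 * q * qs \<le> - k * (p0 + q0) * (p + q)"
    using \<open>L > 0\<close> by (rule mult_left_le_imp_le)
  also have "\<dots> \<le> (k * (p0 + q0))\<^sup>2 / 2 + (p + q)\<^sup>2 / 2"
  proof -
    have "- X * Y \<le> X\<^sup>2 / 2 + Y\<^sup>2 / 2" for X Y :: real
      using zero_le_power2[of "X + Y"] by (simp add: power2_sum field_simps)
    from this[of "k * (p0 + q0)" "p + q"] show ?thesis by simp
  qed
  also have "\<dots> \<le> k\<^sup>2 * (p0\<^sup>2 + q0\<^sup>2) + (p\<^sup>2 + q\<^sup>2)"
  proof -
    have sq: "(a + b)\<^sup>2 / 2 \<le> a\<^sup>2 + b\<^sup>2" for a b :: real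
      using zero_le_power2[of "a - b"] by (simp add: power2_eq_square algebra_simps)
    have "(k * (p0 + q0))\<^sup>2 / 2 = k\<^sup>2 * ((p0 + q0)\<^sup>2 / 2)" by (simp add: power_mult_distrib)
    also have "\<dots> \<le> k\<^sup>2 * (p0\<^sup>2 + q0\<^sup>2)" by (intro mult_left_mono sq) auto
    finally show ?thesis using sq[of p q] by simp
  qed
  finally show ?thesis .
qed

text \<open>By the hypotheses, \<open>e\<^bsup>a-u\<^esup> G(u) - \<integral>\<^sub>a\<^sup>u h\<close> is nonincreasing and starts at \<open>0\<close>.\<close>

lemma gronwall_from_zero:
  fixes G G' h :: "real \<Rightarrow> real"
  assumes G: "\<And>u. u \<in> {a..b} \<Longrightarrow> (G has_real_derivative G' u) (at u within {a..b})"
    and le: "\<And>u. u \<in> {a..b} \<Longrightarrow> G' u \<le> h u + G u"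
    and h: "continuous_on {a..b} h" "\<And>u. u \<in> {a..b} \<Longrightarrow> 0 \<le> h u"
    and "G a = 0" and u: "u \<in> {a..b}"
  shows "G u \<le> exp (b - a) * integral {a..b} h"
proof -
  define D where "D u = exp (a - u) * G u - integral {a..u} h" for u
  have D: "(D has_real_derivative exp (a - v) * (G' v - G v) - h v) (at v within {a..b})"
    if v: "v \<in> {a..b}" for v
    unfolding D_def
    by (rule derivative_eq_intros G[OF v] integral_has_real_derivative[OF h(1) v] refl)+
      (simp add: algebra_simps)
  have "D a \<ge> D u"
  proof (rule DERIV_nonpos_imp_decreasing_open[of a u D])
    fix v assume v: "a < v" "v < u"
    then have vab: "v \<in> {a..b}" using u by auto
    have "at v within {a..b} = at v" using v u by (intro at_within_Icc_at) auto
    then have D': "DERIV D v :> exp (a - v) * (G' v - G v) - h v" using D[OF vab] by simp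
    have "exp (a - v) * (G' v - G v) \<le> exp (a - v) * h v"
      using le[OF vab] by (intro mult_left_mono) auto
    also have "\<dots> \<le> h v"
      using h(2)[OF vab] v by (simp add: mult_left_le_one_le)
    finally show "\<exists>y. DERIV D v :> y \<and> y \<le> 0"
      by (intro exI[of _ "exp (a - v) * (G' v - G v) - h v"] conjI D') simp
  next
    show "continuous_on {a..u} D"
      using u D by (intro continuous_on_subset[OF DERIV_continuous_on[of "{a..b}" D]]) auto
  qed (use u in auto)
  then have "exp (a - u) * G u \<le> integral {a..u} h" using \<open>G a = 0\<close> by (simp add: D_def)
  also have "\<dots> \<le> integral {a..b} h"
    using u h by (intro integral_subset_le)
      (auto intro!: integrable_continuous_real continuous_on_subset[OF h(1)])
  finally have le: "exp (a - u) * G u \<le> integral {a..b} h" .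
  have "G u = exp (u - a) * (exp (a - u) * G u)"
    by (simp add: mult.assoc[symmetric] exp_add[symmetric])
  also have "\<dots> \<le> exp (u - a) * integral {a..b} h" using le by simp
  also have "\<dots> \<le> exp (b - a) * integral {a..b} h"
    using u h by (intro mult_right_mono integral_nonneg) (auto intro: integrable_continuous_real)
  finally show ?thesis .
qed

text \<open>Integrating the pointwise bound over a slice. The derivative of \<open>\<integral> p\<^sup>2\<close> is taken in the form
  that involves the endpoint \<open>(u, 0)\<close> and \<open>p\<^sub>t\<close>, that of \<open>\<integral> q\<^sup>2\<close> in the form that involves \<open>(0, u)\<close>
  and \<open>q\<^sub>s\<close>: these are the endpoints where \<open>p\<close> and \<open>q\<close>, respectively, are zero, and the second
  derivatives that the differential equation controls.\<close>

lemma slice_energy_growth: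
  assumes cC: "0 < c" "c < C"
    and lam: "\<forall>u\<in>{c..C}. lam0 u > 0" "\<forall>u\<in>{c..C}. deriv_on {c..C} lam0 u > 0"
    and x0: "C2_on2 (Omega c C) x0"
    and x1: "first_order_variation c C lam0 dlam x0 x1"
  defines "k \<equiv> rel_perturbation_deriv c C lam0 dlam"
    and "G \<equiv> (\<lambda>x. slice_integral
      (\<lambda>z. (partial_s (Omega c C) x z)\<^sup>2 + (partial_t (Omega c C) x z)\<^sup>2))"
  shows "G x1 c = 0"
    and "u \<in> {c..C} \<Longrightarrow>
      \<exists>d. (G x1 has_real_derivative d) (at u within {c..C}) \<and> d \<le> (k u)\<^sup>2 * G x0 u + G x1 u"
proof -
  let ?O = "Omega c C"
  define p q where "p = partial_s ?O x1" and "q = partial_t ?O x1"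
  define p0 q0 where "p0 = partial_s ?O x0" and "q0 = partial_t ?O x0"
  have sol: "C2_solution c C lam0 (variation_source c C lam0 dlam x0) x1"
    using x1 by (simp add: first_order_variation_def)
  then have C2: "C2_on2 ?O x1" by (simp add: C2_solution_def)
  then have P: "C1_with_partials ?O x1 p q"
    "C1_with_partials ?O p (partial_s ?O p) (partial_t ?O p)"
    "C1_with_partials ?O q (partial_s ?O q) (partial_t ?O q)"
    by (simp_all add: C2_on2_def C1_on2_imp_C1_with_partials p_def q_def)
  have zero_data: "\<forall>s\<in>{c..C}. x1 (s, 0) = 0" "\<forall>t\<in>{c..C}. x1 (0, t) = 0"
    "0 \<le> s \<Longrightarrow> 0 \<le> t \<Longrightarrow> s + t = c \<Longrightarrow> x1 (s, t) = 0 \<and> p (s, t) + q (s, t) = 0" for s t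
    using x1 unfolding first_order_variation_def p_def q_def by blast+
  have bdry: "u \<in> {c..C} \<Longrightarrow> p (u, 0) = 0" "u \<in> {c..C} \<Longrightarrow> q (0, u) = 0"
    "0 \<le> s \<Longrightarrow> 0 \<le> t \<Longrightarrow> s + t = c \<Longrightarrow> p (s, t) = 0 \<and> q (s, t) = 0" for u s t
    using vanishing_boundary_partials[OF P(1) cC zero_data] by blast+
  have G1: "G x1 = slice_integral (\<lambda>z. (p z)\<^sup>2 + (q z)\<^sup>2)" by (simp add: G_def p_def q_def)
  have G0: "G x0 = slice_integral (\<lambda>z. (p0 z)\<^sup>2 + (q0 z)\<^sup>2)" by (simp add: G_def p0_def q0_def)
  show "G x1 c = 0"
    unfolding G1
    by (rule slice_integral_eq_0[OF cC(1)]) (use bdry(3) cC in \<open>auto simp: Omega_def\<close>)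
  have eq_p: "2 * lam0 (s + t) * partial_t ?O p (s, t) + deriv_on {c..C} lam0 (s + t) * (p (s, t) + q (s, t))
      = - lam0 (s + t) * k (s + t) * (p0 (s, t) + q0 (s, t))" if "(s, t) \<in> ?O" for s t
    using sol that
    by (auto simp: C2_solution_def variation_source_def p_def q_def p0_def q0_def k_def)
  have mixed: "partial_t ?O p z = partial_s ?O q z" if "z \<in> ?O" for z
    using C2_on2_mixed_partials_commute[OF C2 convex_Omega interior_Omega_nonempty[OF cC] that]
    by (simp add: p_def q_def)
  have cont: "continuous_on ?O p" "continuous_on ?O q" "continuous_on ?O (partial_t ?O p)"
    "continuous_on ?O (partial_s ?O q)"
    using P by (auto simp: C1_with_partials_def)
  have cont0: "continuous_on ?O p0" "continuous_on ?O q0"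
    using x0 by (auto simp: C2_on2_def C1_on2_def p0_def q0_def)
  have sum: "slice_integral (\<lambda>z. (p z)\<^sup>2 + (q z)\<^sup>2) v
      = slice_integral (\<lambda>z. (p z)\<^sup>2) v + slice_integral (\<lambda>z. (q z)\<^sup>2) v" if "v \<in> {c..C}" for v
    by (intro slice_integral_add[OF cC(1) that] continuous_intros cont)
  assume u: "u \<in> {c..C}"
  let ?dp = "\<lambda>z. 2 * p z * partial_t ?O p z" and ?dq = "\<lambda>z. 2 * q z * partial_s ?O q z"
  have "(slice_integral (\<lambda>z. (p z)\<^sup>2) has_real_derivative slice_integral ?dp u) (at u within {c..C})"
    using slice_integral_has_derivative(1)[OF C1_with_partials_power2[OF P(2)] cC(1) u] bdry(1)[OF u]
    by simp
  moreover have "(slice_integral (\<lambda>z. (q z)\<^sup>2) has_real_derivative slice_integral ?dq u) (at u within {c..C})"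
    using slice_integral_has_derivative(2)[OF C1_with_partials_power2[OF P(3)] cC(1) u] bdry(2)[OF u]
    by simp
  ultimately have "((\<lambda>u. slice_integral (\<lambda>z. (p z)\<^sup>2) u + slice_integral (\<lambda>z. (q z)\<^sup>2) u)
      has_real_derivative slice_integral ?dp u + slice_integral ?dq u) (at u within {c..C})"
    by (rule DERIV_add)
  then have "(G x1 has_real_derivative slice_integral ?dp u + slice_integral ?dq u) (at u within {c..C})"
    unfolding has_field_derivative_def
    by (rule has_derivative_transform[OF u, rotated])
      (unfold G1, rule sum)
  moreover have "slice_integral ?dp u + slice_integral ?dq u = slice_integral (\<lambda>z. ?dp z + ?dq z) u"
    by (intro slice_integral_add[OF cC(1) u, symmetric] continuous_intros cont)
  moreover have "slice_integral (\<lambda>z. ?dp z + ?dq z) u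
      \<le> slice_integral (\<lambda>z. (k u)\<^sup>2 * ((p0 z)\<^sup>2 + (q0 z)\<^sup>2) + ((p z)\<^sup>2 + (q z)\<^sup>2)) u"
  proof (intro slice_integral_mono[OF cC(1) u] continuous_intros cont cont0)
    fix s t assume st: "(s, t) \<in> ?O" "s + t = u"
    show "?dp (s, t) + ?dq (s, t)
        \<le> (k u)\<^sup>2 * ((p0 (s, t))\<^sup>2 + (q0 (s, t))\<^sup>2) + ((p (s, t))\<^sup>2 + (q (s, t))\<^sup>2)"
      using lam u eq_p[OF st(1)] mixed[OF st(1)] st(2)
      by (intro energy_density_growth_bound[of "lam0 u" "deriv_on {c..C} lam0 u"]) auto
  qed
  moreover have "slice_integral (\<lambda>z. (k u)\<^sup>2 * ((p0 z)\<^sup>2 + (q0 z)\<^sup>2) + ((p z)\<^sup>2 + (q z)\<^sup>2)) u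
      = (k u)\<^sup>2 * G x0 u + G x1 u"
    unfolding G0 G1 slice_integral_mult[symmetric]
    by (intro slice_integral_add[OF cC(1) u] continuous_intros cont cont0)
  ultimately show "\<exists>d. (G x1 has_real_derivative d) (at u within {c..C}) \<and>
      d \<le> (k u)\<^sup>2 * G x0 u + G x1 u"
    by auto
qed

lemma continuous_on_rel_perturbation_deriv:
  assumes "c < C" and lam: "C1_on {c..C} lam0" "\<forall>u\<in>{c..C}. lam0 u > 0" and "C1_on {c..C} dlam"
  shows "continuous_on {c..C} (rel_perturbation_deriv c C lam0 dlam)"
proof -
  have D: "(f has_real_derivative deriv_on {c..C} f u) (at u within {c..C})"
    if "C1_on {c..C} f" "u \<in> {c..C}" for f u
    using that
    by (auto simp: C1_on_def deriv_on_def differentiable_on_def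
      has_real_derivative_iff_has_vector_derivative vector_derivative_works)
  have C: "continuous_on {c..C} f" "continuous_on {c..C} (deriv_on {c..C} f)"
    if "C1_on {c..C} f" for f
    using that by (auto simp: C1_on_def differentiable_imp_continuous_on)
  have eq: "rel_perturbation_deriv c C lam0 dlam u =
      (deriv_on {c..C} dlam u * lam0 u - dlam u * deriv_on {c..C} lam0 u) / (lam0 u * lam0 u)"
    if u: "u \<in> {c..C}" for u
  proof -
    have "((\<lambda>u. dlam u / lam0 u) has_real_derivative
        (deriv_on {c..C} dlam u * lam0 u - dlam u * deriv_on {c..C} lam0 u) / (lam0 u * lam0 u))
        (at u within {c..C})"
      by (rule DERIV_divide) (use D assms u in force)+
    then show ?thesis
      using \<open>c < C\<close> u vector_derivative_within_cbox[of c C u "\<lambda>u. dlam u / lam0 u"]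
      by (simp add: rel_perturbation_deriv_def deriv_on_def
        has_real_derivative_iff_has_vector_derivative)
  qed
  have cont: "continuous_on {c..C} (\<lambda>u.
      (deriv_on {c..C} dlam u * lam0 u - dlam u * deriv_on {c..C} lam0 u) / (lam0 u * lam0 u))"
    using lam assms(4) by (intro continuous_intros C) (auto simp: less_imp_neq[symmetric] dest!: bspec)
  show ?thesis by (rule continuous_on_eq[OF cont eq[symmetric]])
qed

text \<open>This guarantees that the energy is bounded on \<open>[c, C]\<close>, so that its supremum is an upper bound.\<close>

lemma continuous_on_energy:
  assumes "0 < c" "C2_on2 (Omega c C) x" "continuous_on {c..C} lam"
  shows "continuous_on {c..C} (energy c C lam x)"
proof -
  let ?p = "partial_s (Omega c C) x" and ?q = "partial_t (Omega c C) x"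
  have p: "C1_with_partials (Omega c C) ?p (partial_s (Omega c C) ?p) (partial_t (Omega c C) ?p)"
    and q: "C1_with_partials (Omega c C) ?q (partial_s (Omega c C) ?q) (partial_t (Omega c C) ?q)"
    using assms by (simp_all add: C2_on2_def C1_on2_imp_C1_with_partials)
  note cont = C1_with_partials_continuous[OF p] C1_with_partials_continuous[OF q]
  have "continuous_on {c..C} (slice_integral (\<lambda>z. (f z)\<^sup>2))"
    if "C1_with_partials (Omega c C) f fs ft" for f fs ft
    by (rule DERIV_continuous_on)
      (rule slice_integral_has_derivative(1)[OF C1_with_partials_power2[OF that] assms(1)])
  from this[OF p] this[OF q]
  have ce: "continuous_on {c..C} (\<lambda>u. lam u *
      (slice_integral (\<lambda>z. (?p z)\<^sup>2) u + slice_integral (\<lambda>z. (?q z)\<^sup>2) u))"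
    by (intro continuous_intros assms)
  have eq: "energy c C lam x u = lam u *
      (slice_integral (\<lambda>z. (?p z)\<^sup>2) u + slice_integral (\<lambda>z. (?q z)\<^sup>2) u)" if "u \<in> {c..C}" for u
    unfolding energy_eq_slice_integral[OF assms(1) that assms(2)]
    by (subst slice_integral_add[OF assms(1) that]) (auto intro!: continuous_intros cont)
  show ?thesis by (rule continuous_on_eq[OF ce eq[symmetric]])
qed

lemma first_order_energy_bound:
  assumes cC: "0 < c" "c < C"
    and lam: "C1_on {c..C} lam0" "\<forall>u\<in>{c..C}. deriv_on {c..C} lam0 u > 0"
    and m: "0 < m" and mB: "\<And>u. u \<in> {c..C} \<Longrightarrow> m \<le> lam0 u \<and> lam0 u \<le> B"
    and x0: "C2_on2 (Omega c C) x0"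
    and dlam: "C1_on {c..C} dlam"
    and x1: "first_order_variation c C lam0 dlam x0 x1"
    and A: "\<And>u. u \<in> {c..C} \<Longrightarrow> energy c C lam0 x0 u \<le> A"
    and u: "u \<in> {c..C}"
  shows "energy c C lam0 x1 u \<le> B / m\<^sup>2 * exp (C - c) * A *
    (weighted_L2_norm c C lam0 (rel_perturbation_deriv c C lam0 dlam))\<^sup>2"
proof -
  define k where "k = rel_perturbation_deriv c C lam0 dlam"
  define G where "G x = slice_integral
      (\<lambda>z. (partial_s (Omega c C) x z)\<^sup>2 + (partial_t (Omega c C) x z)\<^sup>2)" for x
  have pos: "\<forall>u\<in>{c..C}. lam0 u > 0" using mB m by force
  have C2: "C2_on2 (Omega c C) x1"
    using x1 by (simp add: first_order_variation_def C2_solution_def)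
  have E: "energy c C lam0 x u = lam0 u * G x u" if "C2_on2 (Omega c C) x" "u \<in> {c..C}" for x u
    using energy_eq_slice_integral[OF cC(1) that(2,1)] by (simp add: G_def)
  have G_nonneg: "0 \<le> G x u" if "C2_on2 (Omega c C) x" "u \<in> {c..C}" for x u
    unfolding G_def
    by (rule slice_integral_nonneg[OF cC(1) that(2)])
      (use that(1) in \<open>auto simp: C2_on2_def C1_on2_def intro!: continuous_intros\<close>)
  have A0: "0 \<le> A"
    using A[OF u] G_nonneg[OF x0 u] E[OF x0 u] pos u by (smt (verit) mult_nonneg_nonneg)
  have ck: "continuous_on {c..C} k"
    unfolding k_def by (rule continuous_on_rel_perturbation_deriv[OF cC(2) lam(1) pos dlam])
  have cl: "continuous_on {c..C} lam0"
    using lam(1) by (simp add: C1_on_def differentiable_imp_continuous_on)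
  let ?h = "\<lambda>u. A / m\<^sup>2 * (\<bar>k u\<bar>\<^sup>2 * lam0 u)"
  have G0: "G x0 v \<le> A / m\<^sup>2 * lam0 v" if v: "v \<in> {c..C}" for v
  proof -
    \<comment> \<open>One factor \<open>\<lambda>\<^sub>0\<close> turns \<open>G\<close> into the energy, the other becomes the weight of the norm.\<close>
    have "m\<^sup>2 * G x0 v \<le> (lam0 v)\<^sup>2 * G x0 v"
      using mB[OF v] m G_nonneg[OF x0 v] by (intro mult_right_mono power_mono) auto
    also have "\<dots> = lam0 v * energy c C lam0 x0 v" by (simp add: E[OF x0 v] power2_eq_square)
    also have "\<dots> \<le> lam0 v * A" using A[OF v] pos v by simp
    finally show ?thesis using m by (simp add: field_simps)
  qed
  note growth = slice_energy_growth[OF cC pos lam(2) x0 x1, folded k_def G_def]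
  have "\<exists>d. (G x1 has_real_derivative d) (at v within {c..C}) \<and> d \<le> ?h v + G x1 v"
    if v: "v \<in> {c..C}" for v
  proof -
    have "(k v)\<^sup>2 * G x0 v \<le> ?h v"
      using mult_left_mono[OF G0[OF v], of "(k v)\<^sup>2"] by (simp add: algebra_simps)
    then show ?thesis using growth(2)[OF v] by force
  qed
  then obtain G' where G': "\<And>v. v \<in> {c..C} \<Longrightarrow>
      (G x1 has_real_derivative G' v) (at v within {c..C}) \<and> G' v \<le> ?h v + G x1 v"
    by metis
  have "G x1 u \<le> exp (C - c) * integral {c..C} ?h"
  proof (rule gronwall_from_zero[of c C "G x1" G'])
    show "continuous_on {c..C} ?h" by (intro continuous_intros ck cl)
    show "0 \<le> ?h v" if "v \<in> {c..C}" for v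
      using that A0 pos by (intro mult_nonneg_nonneg divide_nonneg_nonneg) (auto simp: less_imp_le)
  qed (use G' growth(1) u in auto)
  moreover have "(weighted_L2_norm c C lam0 k)\<^sup>2 = integral {c..C} (\<lambda>u. \<bar>k u\<bar>\<^sup>2 * lam0 u)"
    unfolding weighted_L2_norm_def
    by (intro real_sqrt_pow2 integral_nonneg integrable_continuous_real continuous_intros ck cl)
      (use pos in \<open>auto intro!: mult_nonneg_nonneg simp: less_imp_le\<close>)
  ultimately have "G x1 u \<le> exp (C - c) * (A / m\<^sup>2 * (weighted_L2_norm c C lam0 k)\<^sup>2)" by simp
  then have "lam0 u * G x1 u \<le> B * (exp (C - c) * (A / m\<^sup>2 * (weighted_L2_norm c C lam0 k)\<^sup>2))"
    using mB[OF u] m G_nonneg[OF C2 u] by (intro mult_mono) auto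
  then show ?thesis by (simp add: E[OF C2 u] k_def algebra_simps)
qed

theorem proposition7p4:
  fixes c C :: real and lam0 :: "real \<Rightarrow> real"
  assumes "0 < c" and "c < C"
    and "smooth_on {c..C} lam0"
    and "\<forall>u\<in>{c..C}. lam0 u > 0"
    and "\<forall>u\<in>{c..C}. deriv_on {c..C} lam0 u > 0"
  shows "\<exists>M::real. \<forall>(x0 :: real \<times> real \<Rightarrow> real) (dlam :: real \<Rightarrow> real) (x1 :: real \<times> real \<Rightarrow> real).
     C2_solution c C lam0 (\<lambda>_. 0) x0 \<longrightarrow>
     C1_on {c..C} dlam \<longrightarrow>
     first_order_variation c C lam0 dlam x0 x1 \<longrightarrow>
     (SUP u\<in>{c..C}. energy c C lam0 x1 u)
       \<le> M * (SUP u\<in>{c..C}. energy c C lam0 x0 u)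
           * (weighted_L2_norm c C lam0 (rel_perturbation_deriv c C lam0 dlam))\<^sup>2"
proof -
  have lam1: "C1_on {c..C} lam0"
    using assms(3)[unfolded smooth_on_def, rule_format, of 0]
      assms(3)[unfolded smooth_on_def, rule_format, of 1]
    by (simp add: C1_on_def differentiable_imp_continuous_on)
  then have cl: "continuous_on {c..C} lam0"
    by (simp add: C1_on_def differentiable_imp_continuous_on)
  obtain a where a: "a \<in> {c..C}" "\<And>u. u \<in> {c..C} \<Longrightarrow> lam0 a \<le> lam0 u"
    using continuous_attains_inf[OF _ _ cl] \<open>c < C\<close> by auto
  obtain b where b: "b \<in> {c..C}" "\<And>u. u \<in> {c..C} \<Longrightarrow> lam0 u \<le> lam0 b"
    using continuous_attains_sup[OF _ _ cl] \<open>c < C\<close> by auto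
  have "(SUP u\<in>{c..C}. energy c C lam0 x1 u)
      \<le> lam0 b / (lam0 a)\<^sup>2 * exp (C - c) * (SUP u\<in>{c..C}. energy c C lam0 x0 u)
           * (weighted_L2_norm c C lam0 (rel_perturbation_deriv c C lam0 dlam))\<^sup>2"
    if x0: "C2_solution c C lam0 (\<lambda>_. 0) x0" and dlam: "C1_on {c..C} dlam"
      and x1: "first_order_variation c C lam0 dlam x0 x1" for x0 dlam x1
  proof (rule cSUP_least)
    fix u assume u: "u \<in> {c..C}"
    have C2: "C2_on2 (Omega c C) x0" using x0 by (simp add: C2_solution_def)
    have "bdd_above (energy c C lam0 x0 ` {c..C})"
      using continuous_on_energy[OF assms(1) C2 cl]
      by (intro bounded_imp_bdd_above compact_imp_bounded compact_continuous_image) auto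
    then have "energy c C lam0 x0 v \<le> (SUP u\<in>{c..C}. energy c C lam0 x0 u)" if "v \<in> {c..C}" for v
      using that by (rule cSUP_upper[rotated])
    then show "energy c C lam0 x1 u \<le> lam0 b / (lam0 a)\<^sup>2 * exp (C - c) *
        (SUP u\<in>{c..C}. energy c C lam0 x0 u) *
        (weighted_L2_norm c C lam0 (rel_perturbation_deriv c C lam0 dlam))\<^sup>2"
      using first_order_energy_bound[OF assms(1,2) lam1 assms(5) _ _ C2 dlam x1 _ u] a b assms(4)
      by blast
  qed (use \<open>c < C\<close> in auto)
  then show ?thesis by blast
qed

end
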